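(* Let $R$ be a nonzero commutative unital ring and let $n\geq 4$ be an integer. There exists an $n\times n$ matrix $T$ over $R$ with $T^2=0_n$ such that $T$ is not similar to any multiple of $E_{1n}$; that is, there are no $r\in R$ and invertible $U\in\mathbb{M}_n(R)$ with $U^{-1}TU=rE_{1n}$.
   Context: $\mathbb{M}_n(R)$ is the ring of $n\times n$ matrices over $R$, $0_n$ is the zero $n\times n$ matrix, and $E_{1n}$ is the $n\times n$ matrix whose $(1,n)$ entry is $1$ and whose other entries are all $0$. *)

theory Defs
  imports "Jordan_Normal_Form.Matrix"
begin

(* The matrix E_{1n}. Rows and columns are numbered from 0, so the (1,n) entry
   of the mathematical text is at position (0, n - 1). *)
definition E1n :: "nat \<Rightarrow> 'a :: comm_ring_1 mat" where
  "E1n n = mat n n (\<lambda>(i, j). if i = 0 \<and> j = n - 1 then 1 else 0)"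

end

theory Submission
  imports Defs
begin

text \<open>The square-zero matrix \<open>E\<^sub>1\<^sub>3 + E\<^sub>2\<^sub>4\<close> has a \<open>2 \<times> 2\<close> minor equal to 1, whereas any
  matrix similar to a multiple of \<open>E\<^sub>1\<^sub>n\<close> is a column times a row, so all its
  \<open>2 \<times> 2\<close> minors vanish.\<close>

lemma mult_mat_index_sum:
  assumes "A \<in> carrier_mat m k" "B \<in> carrier_mat k n" "i < m" "j < n"
  shows "(A * B) $$ (i, j) = (\<Sum>l\<in>{0..<k}. A $$ (i, l) * B $$ (l, j))"
  using assms by (simp add: scalar_prod_def)

text \<open>\<open>E1n n\<close> is the outer product of the first and the last unit vector, so it
  selects column 0 of \<open>P\<close> and row \<open>n - 1\<close> of \<open>Q\<close>.\<close>

lemma mult_E1n_mult_index: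
  fixes P Q :: "'a :: comm_ring_1 mat"
  assumes P: "P \<in> carrier_mat n n" and Q: "Q \<in> carrier_mat n n" and i: "i < n" and j: "j < n"
  shows "(P * (r \<cdot>\<^sub>m E1n n) * Q) $$ (i, j) = P $$ (i, 0) * r * Q $$ (n - 1, j)"
proof -
  have n: "0 < n" using i by simp
  have E: "r \<cdot>\<^sub>m E1n n \<in> carrier_mat n n" by (simp add: E1n_def)
  have PE: "(P * (r \<cdot>\<^sub>m E1n n)) $$ (i, k) = (if k = n - 1 then P $$ (i, 0) * r else 0)"
    if k: "k < n" for k
  proof -
    have "(P * (r \<cdot>\<^sub>m E1n n)) $$ (i, k) = (\<Sum>l\<in>{0..<n}. P $$ (i, l) * (r \<cdot>\<^sub>m E1n n) $$ (l, k))"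
      by (rule mult_mat_index_sum[OF P E i k])
    also have "\<dots> = (\<Sum>l\<in>{0..<n}. if l = 0 then (if k = n - 1 then P $$ (i, 0) * r else 0) else 0)"
      using k by (intro sum.cong) (auto simp: E1n_def)
    finally show ?thesis using n by simp
  qed
  have "(P * (r \<cdot>\<^sub>m E1n n) * Q) $$ (i, j)
      = (\<Sum>k\<in>{0..<n}. (P * (r \<cdot>\<^sub>m E1n n)) $$ (i, k) * Q $$ (k, j))"
    by (rule mult_mat_index_sum[OF mult_carrier_mat[OF P E] Q i j])
  also have "\<dots> = (\<Sum>k\<in>{0..<n}. if k = n - 1 then P $$ (i, 0) * r * Q $$ (n - 1, j) else 0)"
    \<comment> \<open>\<open>index_mult_mat\<close> is removed because it could expand the entries
      that \<open>PE\<close> is to rewrite.\<close>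
    by (intro sum.cong) (auto simp: PE simp del: index_mult_mat)
  finally show ?thesis using n by simp
qed

lemma similar_smult_E1n_minor:
  fixes A :: "'a :: comm_ring_1 mat"
  assumes A: "A \<in> carrier_mat n n" and sim: "similar_mat A (r \<cdot>\<^sub>m E1n n)"
    and "i < n" "j < n" "k < n" "l < n"
  shows "A $$ (i, k) * A $$ (j, l) = A $$ (i, l) * A $$ (j, k)"
proof -
  obtain P Q where "similar_mat_wit A (r \<cdot>\<^sub>m E1n n) P Q"
    using sim unfolding similar_mat_def by blast
  note wit = similar_mat_witD2[OF A this]
  have "A $$ (a, b) = P $$ (a, 0) * r * Q $$ (n - 1, b)" if "a < n" "b < n" for a b
    using mult_E1n_mult_index[OF wit(6,7) that, of r] wit(3) by simp
  \<comment> \<open>By commutativity, both sides are the same product of two entries of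
    \<open>P\<close>, two entries of \<open>Q\<close> and two factors \<open>r\<close>.\<close>
  then show ?thesis using assms(3-6) by (simp add: mult_ac)
qed

theorem theorem2p4:
  fixes n :: nat
  assumes "4 \<le> n"
  shows "\<exists>T :: 'a :: comm_ring_1 mat. T \<in> carrier_mat n n \<and> T ^\<^sub>m 2 = 0\<^sub>m n n \<and>
    \<not> (\<exists>r :: 'a. similar_mat T (r \<cdot>\<^sub>m E1n n))"
proof -
  define T :: "'a mat"
    where "T = mat n n (\<lambda>(i, j). if i = 0 \<and> j = 2 \<or> i = 1 \<and> j = 3 then 1 else 0)"
  have T: "T \<in> carrier_mat n n" by (simp add: T_def)
  have "T ^\<^sub>m 2 = T * T" using T by (simp add: numeral_2_eq_2)
  also have "\<dots> = 0\<^sub>m n n"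
    \<comment> \<open>A nonzero term \<open>T $$ (i, l) * T $$ (l, j)\<close> would need l to be 2
      or 3 by the first factor and 0 or 1 by the second.\<close>
    by (rule eq_matI) (auto simp: T_def scalar_prod_def intro!: sum.neutral)
  finally have sq: "T ^\<^sub>m 2 = 0\<^sub>m n n" .
  have "\<not> similar_mat T (r \<cdot>\<^sub>m E1n n)" for r
  proof
    assume "similar_mat T (r \<cdot>\<^sub>m E1n n)"
    \<comment> \<open>Rows 0, 1 and columns 2, 3 of \<open>T\<close> form an identity block, so the
      equation reads 1 = 0, which \<open>comm_ring_1\<close> excludes. Column 3 exists since 4 \<le>
      n.\<close>
    from similar_smult_E1n_minor[OF T this, of 0 1 2 3] assms show False
      by (simp add: T_def)
  qed
  with T sq show ?thesis by blast
qed

end
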